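(* Fix $T\ge 1$, data $u_{1:T}$ ($u_t\in\mathbb{R}^{n_u}$) and $y_{1:T}$ ($y_t\in\mathbb{R}^{n_y}$), a matrix $\Sigma_{v_k}\in\mathbb{S}^{n_y}_{++}$, and smoothed quantities consisting of: the conditional mean $(\hat x_{1|T},\hat w_{1:T})$ of $(x_1,w_{1:T})$ given $y_{1:T}$ under parameters $\theta_k$, the conditional covariance $\Omega$ of $\mathrm{vec}([x_1,w_{1:T-1}])$ given $y_{1:T}$ under $\theta_k$, and vectors $\omega_j=\mathrm{vec}([x_1^j,w^j_{1:T-1}])$, $j=1,\dots,T$, with $\Omega=\sum_{j=1}^T\omega_j\omega_j'$. Let $\lambda^0,\dots,\lambda^T$ be multipliers that do not depend on $\eta$ (each may be a function of $x_{1:T}$ with values in $\mathbb{R}^{Tn_x}$). Define $$\bar Q_3(\eta)=\bar J_{\lambda^0}(\eta,u_{1:T},y_{1:T},\hat x_{1|T},\hat w_{1:T})+\sum_{j=1}^T\bar J_{\lambda^j}(\eta,0,0,x_1^j,w^j_{1:T})+T\,\mathrm{tr}(\Sigma_{v_k}^{-1}\Sigma_v)+T\log\det\Sigma_{v_k}-Tn_y .$$ Then $\bar Q_3$ is a convex function of $\eta$ (with values in $\mathbb{R}\cup\{+\infty\}$), and it is an upper bound for $-Q_3(\gamma,\theta_k)$ with $\gamma=\mathcal{M}(\eta)$: for every $\eta$ with $E$ invertible, $\bar Q_3(\eta)\ge -Q_3(\mathcal{M}(\eta),\theta_k)$.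
   Context: Notation: $|v|_Q^2=v'Qv$; $\mathbb{S}^n_{++}$ is the set of symmetric positive definite $n\times n$ matrices; $\mathrm{vec}$ stacks columns. Explicit model: $x_{t+1}=Ax_t+Bu_t+Gw_t$, $y_t=Cx_t+Du_t+v_t$ with $x_t\in\mathbb{R}^{n_x}$, $w_t\in\mathbb{R}^{n_w}$, and $w_t\sim\mathcal N(0,\Sigma_w)$, $v_t\sim\mathcal N(0,\Sigma_v)$, $x_1\sim\mathcal N(\mu,\Sigma_1)$ all independent. $\theta$ denotes all parameters, $\gamma=\{\Sigma_v,A,B,G,C,D\}$ with $\Sigma_v\in\mathbb{S}^{n_y}_{++}$. $\theta_k$ is a fixed parameter value, whose output-noise covariance is $\Sigma_{v_k}$. Simulation error: $\mathcal{E}(\gamma,u_{1:T},y_{1:T},\xi_1,w_{1:T})=\sum_{t=1}^T|y_t-Cx_t-Du_t|^2_{\Sigma_v^{-1}}$, where $x_1=\xi_1$ and $x_{t+1}=Ax_t+Bu_t+Gw_t$. $-Q_3$ is the function (the negative of $\mathrm{E}_{\theta_k}[\log p_\theta(y_{1:T}\mid x_1,w_{1:T})\mid y_{1:T}]$ up to a positive scale factor and an additive constant) $$-Q_3(\gamma,\theta_k)=\mathcal{E}(\gamma,u_{1:T},y_{1:T},\hat x_{1|T},\hat w_{1:T})+\sum_{j=1}^T\mathcal{E}(\gamma,0,0,x_1^j,w_{1:T}^j)+T\log\det\Sigma_v .$$ (The value of $w_T$ or $w^j_T$ plays no role.) Implicit parametrization: $\eta=\{E,F,K,L,C,D,\Sigma_v,P\}$,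 with $\Sigma_v\in\mathbb{S}^{n_y}_{++}$, $P\in\mathbb{S}^{n_x}_{++}$, representing $Ex_{t+1}=Fx_t+Ku_t+Lw_t$, $y_t=Cx_t+Du_t+v_t$. For $E$ invertible, $\mathcal{M}(\eta)=\{\Sigma_v,E^{-1}F,E^{-1}K,E^{-1}L,C,D\}$, i.e. $A=E^{-1}F$, $B=E^{-1}K$, $G=E^{-1}L$. Dynamics constraint: $\mathcal{F}(\eta,u_{1:T},\xi_1,x_{1:T},w_{1:T})\in\mathbb{R}^{Tn_x}$ is the stacked vector whose first block is $Ex_1-E\xi_1$ and whose $(t+1)$-th block, $1\le t\le T-1$, is $Ex_{t+1}-Fx_t-Ku_t-Lw_t$. Lagrangian relaxation: for a multiplier $\lambda$, $$\bar J_\lambda(\eta,u_{1:T},y_{1:T},\xi_1,w_{1:T})=\sup_{x_{1:T}}\Big\{\sum_{t=1}^T|y_t-Cx_t-Du_t|^2_{\Sigma_v^{-1}}-\lambda'\mathcal{F}(\eta,u_{1:T},\xi_1,x_{1:T},w_{1:T})\Big\}\in\mathbb{R}\cup\{+\infty\},$$ where, if $\lambda$ depends on $x_{1:T}$, it is evaluated at the same $x_{1:T}$ over which the supremum is taken. *)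

theory Defs
  imports "HOL-Probability.Probability"
begin

(* Time runs over 1..T; sequences are functions on nat of which only the values
   on the relevant range matter.  A vector of R^(T n_x) is kept in its T blocks
   of size n_x, again as a function of the block index 1..T. *)

definition wnorm2 :: "real^'n^'n \<Rightarrow> real^'n \<Rightarrow> real" where
  "wnorm2 Q v = v \<bullet> (Q *v v)"

definition sym_posdef :: "real^'n^'n \<Rightarrow> bool" where
  "sym_posdef Q \<longleftrightarrow> transpose Q = Q \<and> (\<forall>v. v \<noteq> 0 \<longrightarrow> 0 < v \<bullet> (Q *v v))"

definition sym_possemidef :: "real^'n^'n \<Rightarrow> bool" where
  "sym_possemidef Q \<longleftrightarrow> transpose Q = Q \<and> (\<forall>v. 0 \<le> v \<bullet> (Q *v v))"


section \<open>Explicit models and simulation error\<close>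

record ('nx::finite, 'nu::finite, 'nw::finite, 'ny::finite) explicit_model =
  SigV :: "real^'ny^'ny"
  matA :: "real^'nx^'nx"
  matB :: "real^'nu^'nx"
  matG :: "real^'nw^'nx"
  matC :: "real^'nx^'ny"
  matD :: "real^'nu^'ny"

record ('nx::finite, 'nu::finite, 'nw::finite, 'ny::finite) gaussian_model =
  "('nx, 'nu, 'nw, 'ny) explicit_model" +
  mu1 :: "real^'nx"
  Sig1 :: "real^'nx^'nx"
  SigW :: "real^'nw^'nw"

(* The state at time 1 is xi; the value at index 0 is a dummy. *)
primrec sim_state ::
  "('nx, 'nu, 'nw, 'ny::finite, 'z) explicit_model_scheme \<Rightarrow> (nat \<Rightarrow> real^'nu) \<Rightarrow> real^'nx
    \<Rightarrow> (nat \<Rightarrow> real^'nw) \<Rightarrow> nat \<Rightarrow> real^'nx" where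
  "sim_state \<gamma> u \<xi> w 0 = \<xi>"
| "sim_state \<gamma> u \<xi> w (Suc t) =
     (if t = 0 then \<xi>
      else matA \<gamma> *v sim_state \<gamma> u \<xi> w t + matB \<gamma> *v u t + matG \<gamma> *v w t)"

definition sim_error ::
  "nat \<Rightarrow> ('nx, 'nu, 'nw, 'ny, 'z) explicit_model_scheme \<Rightarrow> (nat \<Rightarrow> real^'nu)
    \<Rightarrow> (nat \<Rightarrow> real^'ny) \<Rightarrow> real^'nx \<Rightarrow> (nat \<Rightarrow> real^'nw) \<Rightarrow> real" where
  "sim_error T \<gamma> u y \<xi> w =
     (\<Sum>t=1..T. wnorm2 (matrix_inv (SigV \<gamma>))
        (y t - matC \<gamma> *v sim_state \<gamma> u \<xi> w t - matD \<gamma> *v u t))"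

(* xh, wh are the smoothed means; xs j, ws j are the factors of the smoothed covariance.
   The dependence on the current parameter value is through these only. *)
definition neg_Q3 ::
  "nat \<Rightarrow> (nat \<Rightarrow> real^'nu) \<Rightarrow> (nat \<Rightarrow> real^'ny) \<Rightarrow> real^'nx \<Rightarrow> (nat \<Rightarrow> real^'nw)
    \<Rightarrow> (nat \<Rightarrow> real^'nx) \<Rightarrow> (nat \<Rightarrow> nat \<Rightarrow> real^'nw)
    \<Rightarrow> ('nx, 'nu, 'nw, 'ny) explicit_model \<Rightarrow> real" where
  "neg_Q3 T u y xh wh xs ws \<gamma> =
     sim_error T \<gamma> u y xh wh
     + (\<Sum>j=1..T. sim_error T \<gamma> (\<lambda>_. 0) (\<lambda>_. 0) (xs j) (ws j))
     + real T * ln (det (SigV \<gamma>))"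


section \<open>The Gaussian process generated by a model\<close>

definition normal_measure :: "real \<Rightarrow> real \<Rightarrow> real measure" where
  "normal_measure m s2 =
     (if s2 = 0 then return borel m else density lborel (normal_density m (sqrt s2)))"

(* Multivariate normal law, possibly degenerate: every linear functional is normal. *)
definition normal_vector :: "'a measure \<Rightarrow> ('a \<Rightarrow> real^'n) \<Rightarrow> real^'n \<Rightarrow> real^'n^'n \<Rightarrow> bool" where
  "normal_vector M X m S \<longleftrightarrow>
     X \<in> borel_measurable M \<and> sym_possemidef S \<and>
     (\<forall>a. distr M borel (\<lambda>z. a \<bullet> X z) = normal_measure (a \<bullet> m) (a \<bullet> (S *v a)))"

datatype source = Initial | Process nat | Measurement nat

(* indep_vars needs a common codomain, so independence is stated for the
   generated sigma-algebras. *)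
primrec source_events ::
  "'a measure \<Rightarrow> ('a \<Rightarrow> real^'nx) \<Rightarrow> (nat \<Rightarrow> 'a \<Rightarrow> real^'nw) \<Rightarrow> (nat \<Rightarrow> 'a \<Rightarrow> real^'ny)
    \<Rightarrow> source \<Rightarrow> 'a set set" where
  "source_events M X1 W V Initial = sets (vimage_algebra (space M) X1 borel)"
| "source_events M X1 W V (Process t) = sets (vimage_algebra (space M) (W t) borel)"
| "source_events M X1 W V (Measurement t) = sets (vimage_algebra (space M) (V t) borel)"

definition model_noise ::
  "'a measure \<Rightarrow> nat \<Rightarrow> ('nx, 'nu::finite, 'nw, 'ny) gaussian_model
    \<Rightarrow> ('a \<Rightarrow> real^'nx) \<Rightarrow> (nat \<Rightarrow> 'a \<Rightarrow> real^'nw) \<Rightarrow> (nat \<Rightarrow> 'a \<Rightarrow> real^'ny) \<Rightarrow> bool" where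
  "model_noise M T \<theta> X1 W V \<longleftrightarrow>
     prob_space M \<and>
     normal_vector M X1 (mu1 \<theta>) (Sig1 \<theta>) \<and>
     (\<forall>t\<in>{1..T}. normal_vector M (W t) 0 (SigW \<theta>)) \<and>
     (\<forall>t\<in>{1..T}. normal_vector M (V t) 0 (SigV \<theta>)) \<and>
     prob_space.indep_sets M (source_events M X1 W V)
       ({Initial} \<union> Process ` {1..T} \<union> Measurement ` {1..T})"

definition model_output ::
  "('nx, 'nu, 'nw, 'ny) gaussian_model \<Rightarrow> (nat \<Rightarrow> real^'nu)
    \<Rightarrow> ('a \<Rightarrow> real^'nx) \<Rightarrow> (nat \<Rightarrow> 'a \<Rightarrow> real^'nw) \<Rightarrow> (nat \<Rightarrow> 'a \<Rightarrow> real^'ny)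
    \<Rightarrow> nat \<Rightarrow> 'a \<Rightarrow> real^'ny" where
  "model_output \<theta> u X1 W V t z =
     matC \<theta> *v sim_state \<theta> u (X1 z) (\<lambda>s. W s z) t + matD \<theta> *v u t + V t z"


section \<open>Conditioning on the observed outputs\<close>

definition obs_algebra :: "'a measure \<Rightarrow> nat \<Rightarrow> (nat \<Rightarrow> 'a \<Rightarrow> real^'ny) \<Rightarrow> 'a measure" where
  "obs_algebra M T Y =
     vimage_algebra (space M) (\<lambda>z. \<lambda>t\<in>{1..T}. Y t z) (\<Pi>\<^sub>M t\<in>{1..T}. borel)"

(* "E[Z | Y_1..Y_T = y_1..y_T] = c".  A conditional expectation is only determined almost
   surely; its value at the given data is that of the version h depending continuously on
   the data.  That version is unique when the law of Y_1..Y_T has full support, which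
   holds here because the measurement noise covariance is positive definite. *)
definition has_cond_exp_at ::
  "'a measure \<Rightarrow> nat \<Rightarrow> (nat \<Rightarrow> 'a \<Rightarrow> real^'ny) \<Rightarrow> (nat \<Rightarrow> real^'ny)
    \<Rightarrow> ('a \<Rightarrow> real) \<Rightarrow> real \<Rightarrow> bool" where
  "has_cond_exp_at M T Y y Z c \<longleftrightarrow>
     integrable M Z \<and>
     (\<exists>h :: (nat \<Rightarrow> real^'ny) \<Rightarrow> real.
        continuous_on ({1..T} \<rightarrow>\<^sub>E UNIV) h \<and>
        (AE z in M. real_cond_exp M (obs_algebra M T Y) Z z = h (\<lambda>t\<in>{1..T}. Y t z)) \<and>
        h (\<lambda>t\<in>{1..T}. y t) = c)"

definition has_cond_cov_at ::
  "'a measure \<Rightarrow> nat \<Rightarrow> (nat \<Rightarrow> 'a \<Rightarrow> real^'ny) \<Rightarrow> (nat \<Rightarrow> real^'ny)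
    \<Rightarrow> ('a \<Rightarrow> real) \<Rightarrow> ('a \<Rightarrow> real) \<Rightarrow> real \<Rightarrow> bool" where
  "has_cond_cov_at M T Y y Z1 Z2 c \<longleftrightarrow>
     has_cond_exp_at M T Y y
       (\<lambda>z. (Z1 z - real_cond_exp M (obs_algebra M T Y) Z1 z) *
            (Z2 z - real_cond_exp M (obs_algebra M T Y) Z2 z)) c"

(* vec([x, w_1, ..., w_(T-1)]): entry Inl i is entry i of x, entry Inr (t, k) is
   entry k of w_t. *)
definition vec_idx :: "nat \<Rightarrow> ('nx::finite + nat \<times> 'nw::finite) set" where
  "vec_idx T = UNIV <+> ({1..<T} \<times> UNIV)"

primrec vec_xw :: "real^'nx \<Rightarrow> (nat \<Rightarrow> real^'nw) \<Rightarrow> 'nx + nat \<times> 'nw \<Rightarrow> real" where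
  "vec_xw x w (Inl i) = x $ i"
| "vec_xw x w (Inr tk) = w (fst tk) $ (snd tk)"


section \<open>Implicit models and Lagrangian relaxation\<close>

(* (E, F, K, L, C, D, Sv, P); a product type, hence a real vector space. *)
type_synonym ('nx, 'nu, 'nw, 'ny) implicit_model =
  "(real^'nx^'nx) \<times> (real^'nx^'nx) \<times> (real^'nu^'nx) \<times> (real^'nw^'nx) \<times>
   (real^'nx^'ny) \<times> (real^'nu^'ny) \<times> (real^'ny^'ny) \<times> (real^'nx^'nx)"

definition implicit_models ::
  "('nx::finite, 'nu::finite, 'nw::finite, 'ny::finite) implicit_model set" where
  "implicit_models = {(E, F, K, L, C, D, Sv, P). sym_posdef Sv \<and> sym_posdef P}"

fun E_of :: "('nx, 'nu::finite, 'nw::finite, 'ny::finite) implicit_model \<Rightarrow> real^'nx^'nx" where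
  "E_of (E, F, K, L, C, D, Sv, P) = E"

fun Sv_of :: "('nx::finite, 'nu::finite, 'nw::finite, 'ny) implicit_model \<Rightarrow> real^'ny^'ny" where
  "Sv_of (E, F, K, L, C, D, Sv, P) = Sv"

fun to_explicit ::
  "('nx::finite, 'nu::finite, 'nw::finite, 'ny::finite) implicit_model
    \<Rightarrow> ('nx, 'nu, 'nw, 'ny) explicit_model" where
  "to_explicit (E, F, K, L, C, D, Sv, P) =
     \<lparr> SigV = Sv, matA = matrix_inv E ** F, matB = matrix_inv E ** K,
       matG = matrix_inv E ** L, matC = C, matD = D \<rparr>"

fun dyn_residual ::
  "('nx, 'nu, 'nw, 'ny::finite) implicit_model \<Rightarrow> (nat \<Rightarrow> real^'nu) \<Rightarrow> real^'nx
    \<Rightarrow> (nat \<Rightarrow> real^'nx) \<Rightarrow> (nat \<Rightarrow> real^'nw) \<Rightarrow> nat \<Rightarrow> real^'nx" where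
  "dyn_residual (E, F, K, L, C, D, Sv, P) u \<xi> x w t =
     (if t = 1 then E *v x 1 - E *v \<xi>
      else E *v x t - F *v x (t - 1) - K *v u (t - 1) - L *v w (t - 1))"

fun output_cost ::
  "nat \<Rightarrow> ('nx, 'nu, 'nw::finite, 'ny) implicit_model \<Rightarrow> (nat \<Rightarrow> real^'nu) \<Rightarrow> (nat \<Rightarrow> real^'ny)
    \<Rightarrow> (nat \<Rightarrow> real^'nx) \<Rightarrow> real" where
  "output_cost T (E, F, K, L, C, D, Sv, P) u y x =
     (\<Sum>t=1..T. wnorm2 (matrix_inv Sv) (y t - C *v x t - D *v u t))"

(* The supremum is over functions fixed outside 1..T, so that a multiplier
   lam can depend on x_1, ..., x_T only. *)
definition J_bar ::
  "nat \<Rightarrow> ((nat \<Rightarrow> real^'nx) \<Rightarrow> nat \<Rightarrow> real^'nx) \<Rightarrow> ('nx, 'nu, 'nw, 'ny) implicit_model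
    \<Rightarrow> (nat \<Rightarrow> real^'nu) \<Rightarrow> (nat \<Rightarrow> real^'ny) \<Rightarrow> real^'nx \<Rightarrow> (nat \<Rightarrow> real^'nw) \<Rightarrow> ereal" where
  "J_bar T lam \<eta> u y \<xi> w =
     (SUP x \<in> {1..T} \<rightarrow>\<^sub>E UNIV.
        ereal (output_cost T \<eta> u y x - (\<Sum>t=1..T. lam x t \<bullet> dyn_residual \<eta> u \<xi> x w t)))"

definition Q3_bar ::
  "nat \<Rightarrow> (nat \<Rightarrow> real^'nu) \<Rightarrow> (nat \<Rightarrow> real^'ny) \<Rightarrow> real^'nx \<Rightarrow> (nat \<Rightarrow> real^'nw)
    \<Rightarrow> (nat \<Rightarrow> real^'nx) \<Rightarrow> (nat \<Rightarrow> nat \<Rightarrow> real^'nw) \<Rightarrow> real^'ny^'ny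
    \<Rightarrow> (nat \<Rightarrow> (nat \<Rightarrow> real^'nx) \<Rightarrow> nat \<Rightarrow> real^'nx)
    \<Rightarrow> ('nx, 'nu, 'nw, 'ny) implicit_model \<Rightarrow> ereal" where
  "Q3_bar T u y xh wh xs ws Svk lam \<eta> =
     J_bar T (lam 0) \<eta> u y xh wh
     + (\<Sum>j=1..T. J_bar T (lam j) \<eta> (\<lambda>_. 0) (\<lambda>_. 0) (xs j) (ws j))
     + ereal (real T * trace (matrix_inv Svk ** Sv_of \<eta>)
              + real T * ln (det Svk) - real T * real CARD('ny))"

(* Meant for functions that do not take the value minus infinity. *)
definition ereal_convex_on :: "'a::real_vector set \<Rightarrow> ('a \<Rightarrow> ereal) \<Rightarrow> bool" where
  "ereal_convex_on S f \<longleftrightarrow>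
     convex S \<and>
     (\<forall>x\<in>S. \<forall>y\<in>S. \<forall>t. 0 < t \<and> t < 1 \<longrightarrow>
        f ((1 - t) *\<^sub>R x + t *\<^sub>R y) \<le> ereal (1 - t) * f x + ereal t * f y)"

end

(* For each fixed x the relaxed cost is convex in \<eta>: the multiplier term is linear in \<eta>, and
   v' S^-1 v = max_z (2 z'v - z'S z) is jointly convex in (v, S). Suprema and sums preserve convexity.
   For the bound, the simulated trajectory makes the dynamics residual vanish, so each supremum
   dominates the simulation error, while concavity of ln det gives
   ln det S <= tr (S_k^-1 S) + ln det S_k - n. *)

theory Submission
  imports Defs
begin

section \<open>Positive definite matrices\<close>

lemma inner_transpose_mult:
  fixes A :: "real^'n^'m"
  shows "x \<bullet> (transpose A *v y) = (A *v x) \<bullet> y"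
  by (metis dot_lmul_matrix inner_commute transpose_matrix_vector)

text \<open>Lets \<open>eliminate_row\<close> work with the sparse columns of an elimination matrix
  instead of expanding a triple product.\<close>

lemma congruence_nth:
  fixes M :: "real^'n^'n" and P :: "real^'m^'n"
  shows "(transpose P ** M ** P) $ k $ l = column k P \<bullet> (M *v column l P)"
proof -
  have "(transpose P ** M ** P) $ k $ l = axis k 1 \<bullet> ((transpose P ** M ** P) *v axis l 1)"
    by (simp add: matrix_vector_mul_component inner_axis' matrix_vector_mult_basis column_def)
  also have "\<dots> = (P *v axis k 1) \<bullet> (M *v (P *v axis l 1))"
    by (metis inner_transpose_mult matrix_vector_mul_assoc)
  finally show ?thesis
    by (simp add: matrix_vector_mult_basis)
qed

lemma sym_posdef_invertible:
  assumes "sym_posdef S"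
  shows "invertible S"
proof -
  have "x = 0" if "S *v x = 0" for x
    using assms that unfolding sym_posdef_def by force
  then show ?thesis
    by (metis invertible_left_inverse matrix_left_invertible_ker)
qed

lemma sym_posdef_diag_pos:
  assumes "sym_posdef M"
  shows "0 < M $ i $ i"
proof -
  have "0 < axis i 1 \<bullet> (M *v axis i 1)"
    using assms unfolding sym_posdef_def by (simp add: axis_eq_0_iff)
  then show ?thesis
    by (simp add: matrix_vector_mult_basis inner_axis' column_def)
qed

lemma sym_posdef_congruence:
  fixes M P :: "real^'n^'n"
  assumes M: "sym_posdef M" and P: "det P \<noteq> 0"
  shows "sym_posdef (transpose P ** M ** P)"
  unfolding sym_posdef_def
proof (intro conjI allI impI)
  have "transpose M = M"
    using M by (simp add: sym_posdef_def)
  then show "transpose (transpose P ** M ** P) = transpose P ** M ** P"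
    by (simp add: matrix_transpose_mul matrix_mul_assoc)
next
  fix v :: "real^'n"
  assume "v \<noteq> 0"
  moreover have "inj ((*v) P)"
    using P by (simp add: invertible_det_nz[symmetric] inj_matrix_vector_mult)
  ultimately have "P *v v \<noteq> 0"
    by (metis injD matrix_vector_mult_0_right)
  then have "0 < (P *v v) \<bullet> (M *v (P *v v))"
    using M by (simp add: sym_posdef_def)
  then show "0 < v \<bullet> ((transpose P ** M ** P) *v v)"
    by (metis inner_transpose_mult matrix_vector_mul_assoc)
qed

lemma sym_posdef_convex_comb:
  assumes "sym_posdef A" "sym_posdef B" "0 < s" "0 < t"
  shows "sym_posdef (s *\<^sub>R A + t *\<^sub>R B)"
  unfolding sym_posdef_def
proof (intro conjI allI impI)
  show "transpose (s *\<^sub>R A + t *\<^sub>R B) = s *\<^sub>R A + t *\<^sub>R B"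
    using assms by (simp add: sym_posdef_def transpose_def vec_eq_iff)
next
  fix v :: "real^'a"
  assume "v \<noteq> 0"
  then have "0 < s * (v \<bullet> (A *v v)) + t * (v \<bullet> (B *v v))"
    using assms by (intro add_pos_pos mult_pos_pos) (auto simp: sym_posdef_def)
  then show "0 < v \<bullet> ((s *\<^sub>R A + t *\<^sub>R B) *v v)"
    by (simp add: matrix_vector_mult_add_rdistrib scaleR_matrix_vector_assoc[symmetric] inner_add_right)
qed

section \<open>Diagonalization by symmetric elimination\<close>

lemma det_row_perturbed_identity:
  fixes c :: "'n::finite \<Rightarrow> real"
  shows "det (\<chi> k l. if k = l then 1 else if k = i then c l else 0) = 1"
proof -
  \<comment> \<open>The matrix arises from the identity by adding a combination of the other rows to
    row i, which leaves the determinant unchanged.\<close>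
  let ?x = "\<Sum>j\<in>UNIV - {i}. c j *s row j (mat 1 :: real^'n^'n)"
  have "?x \<in> vec.span {row j (mat 1 :: real^'n^'n) |j. j \<noteq> i}"
    by (intro vec.span_sum vec.span_scale vec.span_base) auto
  from det_row_span[OF this] have "det (\<chi> k. if k = i then row i (mat 1) + ?x else row k (mat 1)) = (1::real)"
    by simp
  moreover have "(\<chi> k. if k = i then row i (mat 1) + ?x else row k (mat 1))
      = (\<chi> k l. if k = l then 1 else if k = i then c l else 0)"
    by (auto simp: vec_eq_iff row_def mat_def sum.delta if_distrib[where f = "\<lambda>z. c _ * z"] cong: if_cong)
  ultimately show ?thesis
    by simp
qed

text \<open>One step of symmetric Gaussian elimination; zero rows created by earlier steps survive it.\<close>

lemma eliminate_row:
  fixes M :: "real^'n^'n"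
  assumes M: "sym_posdef M"
  obtains P :: "real^'n^'n" where "det P = 1"
    and "\<And>k l. (transpose P ** M ** P) $ k $ l =
      (if k = i \<or> l = i then if k = l then M $ i $ i else 0
       else M $ k $ l - M $ i $ k * M $ i $ l / M $ i $ i)"
proof
  \<comment> \<open>These are the elimination multipliers for the pivot \<open>M $ i $ i\<close>;
    the value 0 at i leaves the pivot column alone.\<close>
  define c where "c l = (if l = i then 0 else M $ i $ l / M $ i $ i)" for l
  define P :: "real^'n^'n" where "P = (\<chi> k l. if k = l then 1 else if k = i then - c l else 0)"
  show "det P = 1"
    unfolding P_def by (rule det_row_perturbed_identity)
  have col: "column l P = axis l 1 - c l *\<^sub>R axis i 1" for l
    by (auto simp: P_def column_def axis_def vec_eq_iff c_def)
  have Mcol: "axis k 1 \<bullet> (M *v axis l 1) = M $ k $ l" for k l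
    by (simp add: matrix_vector_mult_basis inner_axis' column_def)
  have sym: "M $ k $ l = M $ l $ k" for k l
    using M unfolding sym_posdef_def by (metis transpose_def vec_lambda_beta)
  have pos: "M $ i $ i > 0"
    by (rule sym_posdef_diag_pos[OF M])
  have entry: "(transpose P ** M ** P) $ k $ l
      = M $ k $ l - c l * M $ k $ i - c k * (M $ i $ l - c l * M $ i $ i)" for k l
    unfolding congruence_nth col
    by (simp add: matrix_vector_mult_diff_distrib matrix_vector_mult_scaleR inner_diff_left
        inner_diff_right Mcol algebra_simps)
  show "(transpose P ** M ** P) $ k $ l =
      (if k = i \<or> l = i then if k = l then M $ i $ i else 0
       else M $ k $ l - M $ i $ k * M $ i $ l / M $ i $ i)" for k l
    \<comment> \<open>For l \<noteq> i the bracket in \<open>entry\<close> vanishes, which clears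
      row i and leaves the Schur complement elsewhere. For l = i symmetry of M gives the
      cancellation.\<close>
    using pos sym[of k i] unfolding entry by (auto simp: c_def)
qed

text \<open>Each elimination subtracts the nonnegative number
  \<open>(M $ i $ k)^2 / M $ i $ i\<close> from the diagonal entry at k. Hence the diagonal never
  grows, which is what Hadamard's inequality exploits.\<close>

lemma diagonalize_congruence:
  fixes M :: "real^'n^'n"
  assumes M: "sym_posdef M"
  obtains P :: "real^'n^'n" where "det P = 1"
    and "sym_posdef (transpose P ** M ** P)"
    and "\<And>k l. k \<noteq> l \<Longrightarrow> (transpose P ** M ** P) $ k $ l = 0"
    and "\<And>k. (transpose P ** M ** P) $ k $ k \<le> M $ k $ k"
proof -
  \<comment> \<open>The set I collects the indices whose rows are already cleared off the diagonal;
    \<open>UNIV\<close> is reached at the end.\<close>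
  have "\<exists>P :: real^'n^'n. det P = 1 \<and>
      (\<forall>k l. k \<in> I \<and> k \<noteq> l \<longrightarrow> (transpose P ** M ** P) $ k $ l = 0) \<and>
      (\<forall>k. (transpose P ** M ** P) $ k $ k \<le> M $ k $ k)" for I
  proof (induction I rule: infinite_finite_induct)
    case empty
    show ?case
      by (rule exI[of _ "mat 1"]) simp
  next
    case (insert i I)
    then obtain P :: "real^'n^'n" where P: "det P = 1"
      and zero: "\<And>k l. k \<in> I \<Longrightarrow> k \<noteq> l \<Longrightarrow> (transpose P ** M ** P) $ k $ l = 0"
      and le: "\<And>k. (transpose P ** M ** P) $ k $ k \<le> M $ k $ k"
      by blast
    define N where "N = transpose P ** M ** P"
    have N: "sym_posdef N"
      unfolding N_def using M P by (simp add: sym_posdef_congruence)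
    then have sym: "N $ k $ l = N $ l $ k" for k l
      unfolding sym_posdef_def by (metis transpose_def vec_lambda_beta)
    have pos: "N $ i $ i > 0"
      by (rule sym_posdef_diag_pos[OF N])
    obtain R :: "real^'n^'n" where R: "det R = 1"
      and RN: "\<And>k l. (transpose R ** N ** R) $ k $ l =
        (if k = i \<or> l = i then if k = l then N $ i $ i else 0
         else N $ k $ l - N $ i $ k * N $ i $ l / N $ i $ i)"
      using eliminate_row[OF N, of i] by blast
    have eq: "transpose (P ** R) ** M ** (P ** R) = transpose R ** N ** R"
      by (simp add: N_def matrix_transpose_mul matrix_mul_assoc)
    \<comment> \<open>A row k cleared earlier has \<open>N $ k $ i = 0\<close>, so by symmetry the
      correction term of the new step vanishes on it.\<close>
    have "(transpose R ** N ** R) $ k $ l = 0" if "k \<in> insert i I" "k \<noteq> l" for k l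
      using that zero sym[of k i] by (auto simp: RN N_def[symmetric])
    moreover have "(transpose R ** N ** R) $ k $ k \<le> M $ k $ k" for k
      using le[of k] pos by (auto simp: RN N_def[symmetric] intro: order_trans[rotated])
    ultimately show ?case
      using P R by (intro exI[of _ "P ** R"]) (simp add: eq det_mul)
  qed simp
  from this[of UNIV] show thesis
    using that sym_posdef_congruence[OF M] by auto
qed

section \<open>Positivity of the determinant and Hadamard's inequality\<close>

lemma sym_posdef_det_pos:
  fixes M :: "real^'n^'n"
  assumes "sym_posdef M"
  shows "0 < det M"
proof -
  obtain P :: "real^'n^'n" where P: "det P = 1" "sym_posdef (transpose P ** M ** P)"
    "\<And>k l. k \<noteq> l \<Longrightarrow> (transpose P ** M ** P) $ k $ l = 0"
    using diagonalize_congruence[OF assms] by metis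
  have "det M = det (transpose P ** M ** P)"
    using P(1) by (simp add: det_mul)
  also have "\<dots> > 0"
    using P(2,3) by (simp add: det_diagonal prod_pos sym_posdef_diag_pos)
  finally show ?thesis .
qed

text \<open>A congruence of determinant 1 preserves the determinant, while the one chosen here only
  lowers the diagonal entries; for the resulting diagonal matrix equality holds.\<close>

lemma hadamard_inequality:
  fixes M :: "real^'n^'n"
  assumes "sym_posdef M"
  shows "det M \<le> (\<Prod>i\<in>UNIV. M $ i $ i)"
proof -
  obtain P :: "real^'n^'n" where P: "det P = 1" "sym_posdef (transpose P ** M ** P)"
    "\<And>k l. k \<noteq> l \<Longrightarrow> (transpose P ** M ** P) $ k $ l = 0"
    "\<And>k. (transpose P ** M ** P) $ k $ k \<le> M $ k $ k"
    using diagonalize_congruence[OF assms] by metis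
  have "det M = det (transpose P ** M ** P)"
    using P(1) by (simp add: det_mul)
  also have "\<dots> = (\<Prod>i\<in>UNIV. (transpose P ** M ** P) $ i $ i)"
    using P(3) by (rule det_diagonal)
  also have "\<dots> \<le> (\<Prod>i\<in>UNIV. M $ i $ i)"
    using P(2,4) by (intro prod_mono) (simp add: less_imp_le sym_posdef_diag_pos)
  finally show ?thesis .
qed

section \<open>Tangent bound for the log-determinant\<close>

lemma matrix_inv_mult:
  fixes A :: "real^'n^'n"
  assumes "invertible A"
  shows "A ** matrix_inv A = mat 1" "matrix_inv A ** A = mat 1"
  using someI_ex[OF assms[unfolded invertible_def]] by (auto simp: matrix_inv_def)

text \<open>The congruence of both matrices conjugates \<open>matrix_inv B ** A\<close> by P, and
  the trace is cyclic.\<close>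

lemma trace_mult_congruence:
  fixes A B P :: "real^'n^'n"
  assumes B: "invertible B" and P: "det P \<noteq> 0"
  shows "trace (matrix_inv (transpose P ** B ** P) ** (transpose P ** A ** P)) = trace (matrix_inv B ** A)"
proof -
  have iP: "invertible P" "invertible (transpose P)"
    using P by (simp_all add: invertible_det_nz)
  then have iC: "invertible (transpose P ** B ** P)"
    using B by (simp add: invertible_mult)
  have cancel: "matrix_inv N ** (N ** X) = X" if "invertible N" for N X :: "real^'n^'n"
    by (simp add: matrix_mul_assoc matrix_inv_mult(2)[OF that])
  \<comment> \<open>The expected product is checked by multiplying back, so the inverse of the
    congruent matrix need not be computed.\<close>
  have eq: "(transpose P ** B ** P) ** (matrix_inv P ** matrix_inv B ** A ** P) = transpose P ** A ** P"
    by (metis matrix_inv_mult(1)[OF iP(1)] matrix_inv_mult(1)[OF B] matrix_mul_assoc matrix_mul_rid)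
  have "matrix_inv (transpose P ** B ** P) ** (transpose P ** A ** P) = matrix_inv P ** (matrix_inv B ** A ** P)"
    unfolding eq[symmetric] cancel[OF iC] by (simp add: matrix_mul_assoc)
  then have "trace (matrix_inv (transpose P ** B ** P) ** (transpose P ** A ** P))
      = trace ((matrix_inv B ** A ** P) ** matrix_inv P)"
    by (simp only: trace_mul_sym[of "matrix_inv P"])
  also have "(matrix_inv B ** A ** P) ** matrix_inv P = matrix_inv B ** A"
    by (metis matrix_inv_mult(1)[OF iP(1)] matrix_mul_assoc matrix_mul_rid)
  finally show ?thesis .
qed

text \<open>Tangent bound of the concave function ln det at B. Congruence makes B diagonal, where
  Hadamard's inequality reduces the claim to ln x \<le> x - 1 entry by entry.\<close>

lemma ln_det_le_tangent:
  fixes A B :: "real^'n^'n"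
  assumes A: "sym_posdef A" and B: "sym_posdef B"
  shows "ln (det A) \<le> trace (matrix_inv B ** A) + ln (det B) - real CARD('n)"
proof -
  obtain P :: "real^'n^'n" where P: "det P = 1" and pd: "sym_posdef (transpose P ** B ** P)"
    and diag: "\<And>k l. k \<noteq> l \<Longrightarrow> (transpose P ** B ** P) $ k $ l = 0"
    using diagonalize_congruence[OF B] by metis
  define C where "C = transpose P ** A ** P"
  define D where "D = transpose P ** B ** P"
  have C: "sym_posdef C" and D: "sym_posdef D"
    unfolding C_def D_def using A B P by (simp_all add: sym_posdef_congruence)
  have pos: "C $ i $ i > 0" "D $ i $ i > 0" for i
    using C D by (simp_all add: sym_posdef_diag_pos)
  have dets: "det C = det A" "det D = det B"
    using P by (simp_all add: C_def D_def det_mul)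
  \<comment> \<open>Since D is diagonal, row i of \<open>D ** (matrix_inv D ** C) = C\<close>
    involves a single entry of the unknown product.\<close>
  have inv_diag: "(matrix_inv D ** C) $ i $ i = C $ i $ i / D $ i $ i" for i
  proof -
    have "C $ i $ i = (D ** (matrix_inv D ** C)) $ i $ i"
      by (simp add: matrix_mul_assoc matrix_inv_mult[OF sym_posdef_invertible[OF D]])
    also have "\<dots> = (\<Sum>k\<in>UNIV. D $ i $ k * (matrix_inv D ** C) $ k $ i)"
      by (simp add: matrix_matrix_mult_def)
    also have "\<dots> = D $ i $ i * (matrix_inv D ** C) $ i $ i"
      using diag[folded D_def] by (subst sum.remove[of _ i]) auto
    finally show ?thesis
      using pos[of i] by simp
  qed
  \<comment> \<open>C need not be diagonal; Hadamard's inequality replaces its determinant by the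
    product of its diagonal.\<close>
  have "ln (det A) \<le> ln (\<Prod>i\<in>UNIV. C $ i $ i)"
    using hadamard_inequality[OF C] sym_posdef_det_pos[OF C] by (simp add: dets)
  also have "\<dots> = (\<Sum>i\<in>UNIV. ln (C $ i $ i / D $ i $ i)) + (\<Sum>i\<in>UNIV. ln (D $ i $ i))"
    using pos by (simp add: ln_prod ln_div less_imp_neq[symmetric] sum_subtractf)
  also have "(\<Sum>i\<in>UNIV. ln (D $ i $ i)) = ln (det B)"
    using pos diag[folded D_def] by (simp add: dets[symmetric] det_diagonal ln_prod less_imp_neq[symmetric])
  also have "(\<Sum>i\<in>UNIV. ln (C $ i $ i / D $ i $ i)) \<le> (\<Sum>i\<in>UNIV. C $ i $ i / D $ i $ i - 1)"
    using pos by (intro sum_mono ln_le_minus_one) simp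
  also have "\<dots> = trace (matrix_inv D ** C) - real CARD('n)"
    by (simp add: trace_def inv_diag sum_subtractf)
  also have "trace (matrix_inv D ** C) = trace (matrix_inv B ** A)"
    unfolding C_def D_def using P by (simp add: trace_mult_congruence sym_posdef_invertible[OF B])
  finally show ?thesis
    by simp
qed

section \<open>Joint convexity of the weighted norm in weight and vector\<close>

text \<open>The right-hand side is affine in (S, v), which makes the weighted norm a supremum of affine functions.\<close>

lemma wnorm2_inv_ge:
  fixes S :: "real^'n^'n"
  assumes S: "sym_posdef S"
  shows "2 * (z \<bullet> v) - z \<bullet> (S *v z) \<le> wnorm2 (matrix_inv S) v"
    and "z = matrix_inv S *v v \<Longrightarrow> wnorm2 (matrix_inv S) v = 2 * (z \<bullet> v) - z \<bullet> (S *v z)"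
proof -
  define p where "p = matrix_inv S *v v"
  have Sp: "S *v p = v"
    by (simp add: p_def matrix_vector_mul_assoc matrix_inv_mult[OF sym_posdef_invertible[OF S]])
  have sym: "p \<bullet> (S *v z) = z \<bullet> v"
    using S unfolding sym_posdef_def by (metis Sp inner_commute inner_transpose_mult)
  \<comment> \<open>Completing the square: p is the maximizer of the affine family, and the gap at z
    is the quadratic form of S at z - p.\<close>
  have "0 \<le> (z - p) \<bullet> (S *v (z - p))"
    using S unfolding sym_posdef_def by (cases "z = p") (auto simp: less_imp_le)
  then show "2 * (z \<bullet> v) - z \<bullet> (S *v z) \<le> wnorm2 (matrix_inv S) v"
    by (simp add: matrix_vector_mult_diff_distrib Sp inner_diff_left inner_diff_right sym wnorm2_def
        p_def[symmetric] inner_commute[of v p])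
  show "z = matrix_inv S *v v \<Longrightarrow> wnorm2 (matrix_inv S) v = 2 * (z \<bullet> v) - z \<bullet> (S *v z)"
    by (simp add: wnorm2_def Sp[unfolded p_def] inner_commute)
qed

text \<open>Take z optimal for the combined pair. For this fixed z the expression is affine, and z
  is a possibly suboptimal choice at each of the two endpoints.\<close>

lemma wnorm2_inv_convex:
  fixes S R :: "real^'n^'n"
  assumes S: "sym_posdef S" and R: "sym_posdef R" and s: "0 < s" "0 < t"
  shows "wnorm2 (matrix_inv (s *\<^sub>R S + t *\<^sub>R R)) (s *\<^sub>R v + t *\<^sub>R w)
    \<le> s * wnorm2 (matrix_inv S) v + t * wnorm2 (matrix_inv R) w"
proof -
  let ?Q = "s *\<^sub>R S + t *\<^sub>R R"
  define z where "z = matrix_inv ?Q *v (s *\<^sub>R v + t *\<^sub>R w)"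
  have "wnorm2 (matrix_inv ?Q) (s *\<^sub>R v + t *\<^sub>R w)
      = 2 * (z \<bullet> (s *\<^sub>R v + t *\<^sub>R w)) - z \<bullet> (?Q *v z)"
    using wnorm2_inv_ge(2)[OF sym_posdef_convex_comb[OF S R s] z_def] .
  also have "\<dots> = s * (2 * (z \<bullet> v) - z \<bullet> (S *v z)) + t * (2 * (z \<bullet> w) - z \<bullet> (R *v z))"
    by (simp add: matrix_vector_mult_add_rdistrib scaleR_matrix_vector_assoc[symmetric]
        inner_add_right algebra_simps)
  also have "\<dots> \<le> s * wnorm2 (matrix_inv S) v + t * wnorm2 (matrix_inv R) w"
    using s by (intro add_mono mult_left_mono wnorm2_inv_ge(1) S R) auto
  finally show ?thesis .
qed

section \<open>Convexity of the bound\<close>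

lemma ereal_convex_on_add:
  assumes f: "ereal_convex_on S f" and g: "ereal_convex_on S g"
    and nf: "\<And>x. x \<in> S \<Longrightarrow> f x \<noteq> -\<infinity>" and ng: "\<And>x. x \<in> S \<Longrightarrow> g x \<noteq> -\<infinity>"
  shows "ereal_convex_on S (\<lambda>x. f x + g x)"
  unfolding ereal_convex_on_def
proof (intro conjI ballI allI impI)
  show "convex S"
    using f by (simp add: ereal_convex_on_def)
  fix x y t
  assume *: "x \<in> S" "y \<in> S" "0 < t \<and> t < (1::real)"
  \<comment> \<open>Excluding the value \<open>-\<infinity>\<close> rules out sums of opposite
    infinities, where distributivity could fail.\<close>
  have dist: "ereal a * (f z + g z) = ereal a * f z + ereal a * g z" if "z \<in> S" for a z
    using nf[OF that] ng[OF that] by (intro ereal_distrib_left) auto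
  have "f ((1 - t) *\<^sub>R x + t *\<^sub>R y) + g ((1 - t) *\<^sub>R x + t *\<^sub>R y)
      \<le> (ereal (1 - t) * f x + ereal t * f y) + (ereal (1 - t) * g x + ereal t * g y)"
    using f g * by (intro add_mono) (auto simp: ereal_convex_on_def)
  also have "\<dots> = ereal (1 - t) * (f x + g x) + ereal t * (f y + g y)"
    using * by (simp add: dist add_ac)
  finally show "f ((1 - t) *\<^sub>R x + t *\<^sub>R y) + g ((1 - t) *\<^sub>R x + t *\<^sub>R y)
      \<le> ereal (1 - t) * (f x + g x) + ereal t * (f y + g y)" .
qed

lemma sum_ereal_not_MInf:
  fixes f :: "'a \<Rightarrow> ereal"
  assumes "\<And>i. i \<in> I \<Longrightarrow> f i \<noteq> -\<infinity>"
  shows "sum f I \<noteq> -\<infinity>"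
  using assms by (induction I rule: infinite_finite_induct) auto

text \<open>Convexity of S is a separate premise because no summand supplies it when I is
  empty.\<close>

lemma ereal_convex_on_sum:
  assumes "finite I" "convex S"
    and "\<And>i. i \<in> I \<Longrightarrow> ereal_convex_on S (f i)"
    and "\<And>i x. i \<in> I \<Longrightarrow> x \<in> S \<Longrightarrow> f i x \<noteq> -\<infinity>"
  shows "ereal_convex_on S (\<lambda>x. \<Sum>i\<in>I. f i x)"
  using assms
proof (induction I rule: finite_induct)
  case empty
  then show ?case
    by (simp add: ereal_convex_on_def)
next
  case (insert i I)
  have "(\<Sum>i\<in>I. f i x) \<noteq> -\<infinity>" if "x \<in> S" for x
    using insert.prems(3) that by (simp add: sum_ereal_not_MInf)
  with insert show ?case
    by (simp add: ereal_convex_on_add)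
qed

section \<open>Convexity of the ingredients in the implicit parameters\<close>

lemma convex_implicit_models:
  "convex (implicit_models :: ('nx::finite, 'nu::finite, 'nw::finite, 'ny::finite) implicit_model set)"
proof (rule convexI)
  fix \<eta> \<zeta> :: "('nx, 'nu, 'nw, 'ny) implicit_model" and s t :: real
  assume *: "\<eta> \<in> implicit_models" "\<zeta> \<in> implicit_models" "0 \<le> s" "0 \<le> t" "s + t = 1"
  \<comment> \<open>Positive definiteness of a combination is available for strictly positive
    weights only, so the endpoints are split off.\<close>
  then consider "s = 0" "t = 1" | "s = 1" "t = 0" | "0 < s" "0 < t"
    by fastforce
  then show "s *\<^sub>R \<eta> + t *\<^sub>R \<zeta> \<in> implicit_models"
  proof cases
    case 3
    then show ?thesis
      using *(1,2) by (auto simp: implicit_models_def sym_posdef_convex_comb)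
  qed (use * in simp_all)
qed

text \<open>The implicit form pays off here: along a fixed trajectory no inverse and no product of
  parameters occurs, so the multiplier term cannot spoil convexity.\<close>

lemma dyn_residual_linear:
  "dyn_residual (s *\<^sub>R \<eta> + t *\<^sub>R \<zeta>) u \<xi> x w k =
    s *\<^sub>R dyn_residual \<eta> u \<xi> x w k + t *\<^sub>R dyn_residual \<zeta> u \<xi> x w k"
  by (cases \<eta> rule: E_of.cases; cases \<zeta> rule: E_of.cases)
    (simp add: matrix_vector_mult_add_rdistrib scaleR_matrix_vector_assoc[symmetric]
      scaleR_diff_right)

lemma output_cost_convex:
  assumes "\<eta> \<in> implicit_models" "\<zeta> \<in> implicit_models" and t: "0 < t" "t < 1"
  shows "output_cost T ((1 - t) *\<^sub>R \<eta> + t *\<^sub>R \<zeta>) u y x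
    \<le> (1 - t) * output_cost T \<eta> u y x + t * output_cost T \<zeta> u y x"
proof -
  obtain E F K L C D Sv P where \<eta>: "\<eta> = (E, F, K, L, C, D, Sv, P)"
    by (cases \<eta> rule: E_of.cases)
  obtain E' F' K' L' C' D' Sv' P' where \<zeta>: "\<zeta> = (E', F', K', L', C', D', Sv', P')"
    by (cases \<zeta> rule: E_of.cases)
  have pd: "sym_posdef Sv" "sym_posdef Sv'"
    using assms by (auto simp: \<eta> \<zeta> implicit_models_def)
  \<comment> \<open>The constant \<open>y k\<close> splits because the weights sum to 1.\<close>
  have "y k - ((1 - t) *\<^sub>R C + t *\<^sub>R C') *v x k - ((1 - t) *\<^sub>R D + t *\<^sub>R D') *v u k
      = (1 - t) *\<^sub>R (y k - C *v x k - D *v u k) + t *\<^sub>R (y k - C' *v x k - D' *v u k)" for k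
    by (simp add: matrix_vector_mult_add_rdistrib scaleR_matrix_vector_assoc[symmetric] algebra_simps)
  then have "output_cost T ((1 - t) *\<^sub>R \<eta> + t *\<^sub>R \<zeta>) u y x
      \<le> (\<Sum>k=1..T. (1 - t) * wnorm2 (matrix_inv Sv) (y k - C *v x k - D *v u k)
            + t * wnorm2 (matrix_inv Sv') (y k - C' *v x k - D' *v u k))"
    using t by (auto simp: \<eta> \<zeta> intro!: sum_mono wnorm2_inv_convex pd)
  then show ?thesis
    by (simp add: \<eta> \<zeta> sum.distrib sum_distrib_left)
qed

lemma J_bar_ge:
  assumes "x \<in> {1..T} \<rightarrow>\<^sub>E UNIV"
  shows "ereal (output_cost T \<eta> u y x - (\<Sum>t=1..T. lam x t \<bullet> dyn_residual \<eta> u \<xi> x w t))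
    \<le> J_bar T lam \<eta> u y \<xi> w"
  unfolding J_bar_def using assms by (rule SUP_upper)

text \<open>Any admissible trajectory gives a finite lower bound; the zero trajectory on 1..T serves
  as witness.\<close>

lemma J_bar_not_MInf: "J_bar T lam \<eta> u y \<xi> w \<noteq> -\<infinity>"
  using J_bar_ge[of "\<lambda>t\<in>{1..T}. 0" T \<eta> u y lam \<xi> w] by auto

text \<open>The multiplier depends on x but not on \<eta>, so for each fixed x it is a constant
  vector and the supremum runs over convex functions of \<eta>.\<close>

lemma J_bar_convex: "ereal_convex_on implicit_models (\<lambda>\<eta>. J_bar T lam \<eta> u y \<xi> w)"
  unfolding ereal_convex_on_def
proof (intro conjI ballI allI impI convex_implicit_models)
  fix \<eta> \<zeta> :: "('a, 'b, 'c, 'd) implicit_model" and t :: real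
  assume \<eta>: "\<eta> \<in> implicit_models" "\<zeta> \<in> implicit_models" and t: "0 < t \<and> t < 1"
  let ?c = "\<lambda>\<eta> x. output_cost T \<eta> u y x - (\<Sum>k=1..T. lam x k \<bullet> dyn_residual \<eta> u \<xi> x w k)"
  show "J_bar T lam ((1 - t) *\<^sub>R \<eta> + t *\<^sub>R \<zeta>) u y \<xi> w
      \<le> ereal (1 - t) * J_bar T lam \<eta> u y \<xi> w + ereal t * J_bar T lam \<zeta> u y \<xi> w"
    \<comment> \<open>Only the supremum at the combined point is unfolded; those at the endpoints
      stay folded as upper bounds.\<close>
    unfolding J_bar_def[of T lam "_ + _"]
  proof (rule SUP_least)
    fix x :: "nat \<Rightarrow> real^'a"
    assume x: "x \<in> {1..T} \<rightarrow>\<^sub>E UNIV"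
    have "?c ((1 - t) *\<^sub>R \<eta> + t *\<^sub>R \<zeta>) x \<le> (1 - t) * ?c \<eta> x + t * ?c \<zeta> x"
      using output_cost_convex[OF \<eta>, of t T u y x] t
      by (simp add: dyn_residual_linear inner_add_right sum.distrib sum_distrib_left[symmetric]
          right_diff_distrib)
    then have "ereal (?c ((1 - t) *\<^sub>R \<eta> + t *\<^sub>R \<zeta>) x)
        \<le> ereal (1 - t) * ereal (?c \<eta> x) + ereal t * ereal (?c \<zeta> x)"
      by simp
    also have "\<dots> \<le> ereal (1 - t) * J_bar T lam \<eta> u y \<xi> w + ereal t * J_bar T lam \<zeta> u y \<xi> w"
      using t by (intro add_mono ereal_mult_left_mono J_bar_ge x) auto
    finally show "ereal (?c ((1 - t) *\<^sub>R \<eta> + t *\<^sub>R \<zeta>) x)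
        \<le> ereal (1 - t) * J_bar T lam \<eta> u y \<xi> w + ereal t * J_bar T lam \<zeta> u y \<xi> w" .
  qed
qed

lemma trace_Sv_convex:
  "ereal_convex_on implicit_models (\<lambda>\<eta>. ereal (a * trace (A ** Sv_of \<eta>) + b))"
  unfolding ereal_convex_on_def
proof (intro conjI ballI allI impI convex_implicit_models)
  fix \<eta> \<zeta> :: "('a, 'b, 'c, 'd) implicit_model" and t :: real
  have Sv: "Sv_of ((1 - t) *\<^sub>R \<eta> + t *\<^sub>R \<zeta>) = (1 - t) *\<^sub>R Sv_of \<eta> + t *\<^sub>R Sv_of \<zeta>"
    by (cases \<eta> rule: E_of.cases; cases \<zeta> rule: E_of.cases) simp
  have tr: "trace (A ** Sv_of ((1 - t) *\<^sub>R \<eta> + t *\<^sub>R \<zeta>))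
      = (1 - t) * trace (A ** Sv_of \<eta>) + t * trace (A ** Sv_of \<zeta>)"
    unfolding Sv
    by (simp add: matrix_add_ldistrib trace_add matrix_scalar_ac scalar_matrix_assoc[symmetric])
      (simp add: trace_def sum_distrib_left)
  show "ereal (a * trace (A ** Sv_of ((1 - t) *\<^sub>R \<eta> + t *\<^sub>R \<zeta>)) + b)
      \<le> ereal (1 - t) * ereal (a * trace (A ** Sv_of \<eta>) + b)
        + ereal t * ereal (a * trace (A ** Sv_of \<zeta>) + b)"
    unfolding tr by (simp add: algebra_simps)
qed

section \<open>The upper bound\<close>

text \<open>This is weak duality: at a feasible trajectory the penalty is zero whatever the
  multiplier.\<close>

lemma sim_error_le_J_bar:
  assumes "invertible (E_of \<eta>)"
  shows "ereal (sim_error T (to_explicit \<eta>) u y \<xi> w) \<le> J_bar T lam \<eta> u y \<xi> w"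
proof -
  obtain E F K L C D Sv P where \<eta>: "\<eta> = (E, F, K, L, C, D, Sv, P)"
    by (cases \<eta> rule: E_of.cases)
  define s where "s = sim_state (to_explicit \<eta>) u \<xi> w"
  \<comment> \<open>Restriction puts the simulated states into the extensional function space of the
    supremum and drops the dummy state at index 0.\<close>
  define x where "x = restrict s {1..T}"
  \<comment> \<open>Multiplying the explicit recursion by E undoes the inverse introduced by
    \<open>to_explicit\<close>.\<close>
  have E: "E *v ((matrix_inv E ** N) *v v) = N *v v" for N :: "real^'m^'a" and v
    using assms by (simp add: \<eta> matrix_vector_mul_assoc matrix_mul_assoc matrix_inv_mult)
  have "dyn_residual \<eta> u \<xi> x w k = 0" if "k \<in> {1..T}" for k
  proof (cases "k = 1")
    case True
    then show ?thesis
      using that by (simp add: \<eta> x_def s_def)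
  next
    case False
    \<comment> \<open>Positivity of j selects the dynamic branch of \<open>sim_state\<close>, and
      both j and \<open>Suc j\<close> lie in 1..T, where x agrees with s.\<close>
    with that obtain j where "k = Suc j" "0 < j" "j < T"
      by (cases k) auto
    then show ?thesis
      using False that by (simp add: \<eta> x_def s_def matrix_vector_right_distrib E)
  qed
  then have "(\<Sum>k=1..T. lam x k \<bullet> dyn_residual \<eta> u \<xi> x w k) = 0"
    by simp
  moreover have "output_cost T \<eta> u y x = sim_error T (to_explicit \<eta>) u y \<xi> w"
    by (simp add: \<eta> sim_error_def x_def s_def)
  ultimately show ?thesis
    using J_bar_ge[of x T \<eta> u y lam \<xi> w] by (simp add: x_def)
qed

section \<open>Assembly of the full bound\<close>

lemma Q3_bar_not_MInf: "Q3_bar T u y xh wh xs ws Svk lam \<eta> \<noteq> -\<infinity>"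
  unfolding Q3_bar_def by (simp add: sum_ereal_not_MInf J_bar_not_MInf)

lemma Q3_bar_convex: "ereal_convex_on implicit_models (Q3_bar T u y xh wh xs ws Svk lam)"
proof -
  let ?I = "\<lambda>\<eta>. J_bar T (lam 0) \<eta> u y xh wh"
  let ?J = "\<lambda>\<eta>. \<Sum>j=1..T. J_bar T (lam j) \<eta> (\<lambda>_. 0) (\<lambda>_. 0) (xs j) (ws j)"
  have J_sum: "ereal_convex_on implicit_models ?J"
    by (rule ereal_convex_on_sum) (rule finite_atLeastAtMost convex_implicit_models J_bar_convex J_bar_not_MInf)+
  have "ereal_convex_on implicit_models (\<lambda>\<eta>. ?I \<eta> + ?J \<eta>)"
    by (intro ereal_convex_on_add[OF J_bar_convex J_sum] sum_ereal_not_MInf J_bar_not_MInf)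
  then show ?thesis
    \<comment> \<open>Regrouping brings the last summand into the shape
      \<open>a * trace (A ** Sv_of \<eta>) + b\<close> of \<open>trace_Sv_convex\<close>.\<close>
    unfolding Q3_bar_def diff_conv_add_uminus add.assoc[of "real T * trace _"]
    by (intro ereal_convex_on_add[OF _ trace_Sv_convex])
      (simp_all add: sum_ereal_not_MInf J_bar_not_MInf)
qed

lemma neg_Q3_le_Q3_bar:
  fixes \<eta> :: "('nx::finite, 'nu::finite, 'nw::finite, 'ny::finite) implicit_model"
  assumes \<eta>: "\<eta> \<in> implicit_models" "invertible (E_of \<eta>)" and Svk: "sym_posdef Svk"
  shows "ereal (neg_Q3 T u y xh wh xs ws (to_explicit \<eta>)) \<le> Q3_bar T u y xh wh xs ws Svk lam \<eta>"
proof -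
  have SigV: "SigV (to_explicit \<eta>) = Sv_of \<eta>" and "sym_posdef (Sv_of \<eta>)"
    using \<eta> by (cases \<eta> rule: E_of.cases; simp add: implicit_models_def)+
  then have "real T * ln (det (Sv_of \<eta>))
      \<le> real T * (trace (matrix_inv Svk ** Sv_of \<eta>) + ln (det Svk) - real CARD('ny))"
    by (intro mult_left_mono ln_det_le_tangent Svk) auto
  then have "ereal (real T * ln (det (SigV (to_explicit \<eta>))))
      \<le> ereal (real T * trace (matrix_inv Svk ** Sv_of \<eta>) + real T * ln (det Svk)
          - real T * real CARD('ny))"
    by (simp add: SigV algebra_simps)
  then show ?thesis
    \<comment> \<open>Moving \<open>ereal\<close> inside the sums aligns both sides, so each
      simulation error meets the relaxation with its own multiplier and the log-determinant meets
      its tangent at \<open>Svk\<close>.\<close>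
    unfolding neg_Q3_def Q3_bar_def plus_ereal.simps(1)[symmetric] sum_ereal[symmetric]
    by (intro add_mono sum_mono sim_error_le_J_bar \<eta>)
qed

theorem lemma5:
  fixes T :: nat
    and u :: "nat \<Rightarrow> real^'nu::finite"
    and y :: "nat \<Rightarrow> real^'ny"
    and \<theta>k :: "('nx::finite, 'nu::finite, 'nw::finite, 'ny::finite) gaussian_model"
    and M :: "'a measure"
    and X1 :: "'a \<Rightarrow> real^'nx"
    and W :: "nat \<Rightarrow> 'a \<Rightarrow> real^'nw"
    and V :: "nat \<Rightarrow> 'a \<Rightarrow> real^'ny"
    and xh :: "real^'nx"
    and wh :: "nat \<Rightarrow> real^'nw"
    and \<Omega> :: "'nx::finite + nat \<times> 'nw::finite \<Rightarrow> 'nx + nat \<times> 'nw \<Rightarrow> real"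
    and xs :: "nat \<Rightarrow> real^'nx"
    and ws :: "nat \<Rightarrow> nat \<Rightarrow> real^'nw"
    and lam :: "nat \<Rightarrow> (nat \<Rightarrow> real^'nx) \<Rightarrow> nat \<Rightarrow> real^'nx"
    and Y :: "nat \<Rightarrow> 'a \<Rightarrow> real^'ny"
  assumes T: "1 \<le> T"
    and Svk: "sym_posdef (SigV \<theta>k)"
    and model: "model_noise M T \<theta>k X1 W V"
    and Y_def: "Y = model_output \<theta>k u X1 W V"
    and mean_x1: "\<And>i. has_cond_exp_at M T Y y (\<lambda>z. X1 z $ i) (xh $ i)"
    and mean_w: "\<And>t i. t \<in> {1..T} \<Longrightarrow> has_cond_exp_at M T Y y (\<lambda>z. W t z $ i) (wh t $ i)"
    and cov: "\<And>a b. a \<in> vec_idx T \<Longrightarrow> b \<in> vec_idx T \<Longrightarrow>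
      has_cond_cov_at M T Y y
        (\<lambda>z. vec_xw (X1 z) (\<lambda>t. W t z) a) (\<lambda>z. vec_xw (X1 z) (\<lambda>t. W t z) b) (\<Omega> a b)"
    and cov_factors: "\<And>a b. a \<in> vec_idx T \<Longrightarrow> b \<in> vec_idx T \<Longrightarrow>
      \<Omega> a b = (\<Sum>j=1..T. vec_xw (xs j) (ws j) a * vec_xw (xs j) (ws j) b)"
  shows "(\<forall>\<eta> \<in> implicit_models. Q3_bar T u y xh wh xs ws (SigV \<theta>k) lam \<eta> \<noteq> -\<infinity>)
    \<and> ereal_convex_on implicit_models (Q3_bar T u y xh wh xs ws (SigV \<theta>k) lam)
    \<and> (\<forall>\<eta> \<in> implicit_models. invertible (E_of \<eta>) \<longrightarrow>
          ereal (neg_Q3 T u y xh wh xs ws (to_explicit \<eta>))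
            \<le> Q3_bar T u y xh wh xs ws (SigV \<theta>k) lam \<eta>)"
  by (intro conjI ballI impI Q3_bar_not_MInf Q3_bar_convex neg_Q3_le_Q3_bar[OF _ _ Svk])

end
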